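(* Let $k\in\mathbb{C}$, and let $p(z)=\prod_{i=1}^n(z-x_i)$ and $q(z)=\prod_{i=1}^m(z-y_i)$ be complex polynomials in $z$ (whose roots may depend on $k$) with no repeated roots and no common roots. Put $$\Psi(z)=\frac{p(z)}{q(z)^2}\,e^{kz}.$$ The following three statements are equivalent: (a) Both $$e^{-kz}\int\Psi(z)\,dz\qquad\text{and}\qquad e^{2kz}\int\Psi(z)^{-2}\,dz$$ are rational functions of $z$. (b) The energy function $$E(z_1,\dots,z_{n+m})=\operatorname{Re}\Big(k\sum_{i=1}^{n+m}Q_iz_i\Big)+\sum_{1\le i<j\le n+m}Q_iQ_j\ln|z_i-z_j|,$$ with $Q_i=1$ for $1\le i\le n$ and $Q_i=-2$ for $n+1\le i\le n+m$, has a critical point at $z_i=x_i$ ($1\le i\le n$), $z_i=y_{i-n}$ ($n+1\le i\le n+m$). (c) $p$ and $q$ satisfy, identically in $z$, $$p''q-4p'q'+4pq''+2k\,(p'q-2q'p)=0.$$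
   Context: Primes denote $d/dz$. In (a), "rational" means that for a suitable choice of the antiderivative (integration constant) the expression is a rational function of $z$, i.e. expressible without logarithms. In (b), a critical point of the real function $E$ of complex variables is a point at which all first-order partial derivatives with respect to $\operatorname{Re}z_i$, $\operatorname{Im}z_i$ vanish. *)

theory Defs
  imports "HOL-Complex_Analysis.Complex_Analysis" "HOL-Computational_Algebra.Computational_Algebra"
begin

definition Psi :: "complex \<Rightarrow> complex poly \<Rightarrow> complex poly \<Rightarrow> complex \<Rightarrow> complex" where
  "Psi k p q z = poly p z / poly q z ^ 2 * exp (k * z)"

text \<open>Division by zero yields \<open>0\<close> in HOL, so integrals of \<^const>\<open>Psi\<close> and of its powers are only
  considered where \<^const>\<open>Psi\<close> has neither a zero nor a pole. For coprime \<open>p\<close> and \<open>q\<close> this is:\<close>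

definition regular_set :: "complex poly \<Rightarrow> complex poly \<Rightarrow> complex set" where
  "regular_set p q = {z. poly p z \<noteq> 0 \<and> poly q z \<noteq> 0}"

definition antiderivative_on :: "complex set \<Rightarrow> (complex \<Rightarrow> complex) \<Rightarrow> (complex \<Rightarrow> complex) \<Rightarrow> bool" where
  "antiderivative_on S f F \<longleftrightarrow> (\<forall>z\<in>S. (F has_field_derivative f z) (at z))"

definition rational_on :: "complex set \<Rightarrow> (complex \<Rightarrow> complex) \<Rightarrow> bool" where
  "rational_on S f \<longleftrightarrow>
     (\<exists>a b :: complex poly. b \<noteq> 0 \<and> (\<forall>z\<in>S. poly b z \<noteq> 0 \<and> f z = poly a z / poly b z))"

definition charge :: "nat \<Rightarrow> nat \<Rightarrow> real" where
  "charge n i = (if i \<le> n then 1 else -2)"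

definition energy :: "complex \<Rightarrow> nat \<Rightarrow> nat \<Rightarrow> (nat \<Rightarrow> complex) \<Rightarrow> real" where
  "energy k n m z =
     Re (k * (\<Sum>i=1..n+m. complex_of_real (charge n i) * z i)) +
     (\<Sum>i=1..n+m. \<Sum>j=i+1..n+m. charge n i * charge n j * ln (cmod (z i - z j)))"

text \<open>The partial derivatives with respect to \<open>Re z\<^sub>i\<close> and \<open>Im z\<^sub>i\<close> exist and vanish for each
  \<open>i \<in> I\<close>. A point of \<open>\<complex>\<^sup>N\<close> is a function on \<^typ>\<open>nat\<close> whose values outside \<open>I = {1..N}\<close> are
  irrelevant.\<close>

definition critical_point :: "nat set \<Rightarrow> ((nat \<Rightarrow> complex) \<Rightarrow> real) \<Rightarrow> (nat \<Rightarrow> complex) \<Rightarrow> bool" where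
  "critical_point I E z \<longleftrightarrow>
     (\<forall>i\<in>I.
        ((\<lambda>t. E (z(i := Complex t (Im (z i))))) has_real_derivative 0) (at (Re (z i))) \<and>
        ((\<lambda>t. E (z(i := Complex (Re (z i)) t))) has_real_derivative 0) (at (Im (z i))))"

end

(*
  Each of (a), (b), (c) says that the polynomial H in (c) vanishes at all roots of p and of q. This
  is (c) itself, as H has degree less than deg p + deg q. At a root w, H(w) is a nonzero multiple of
  the force k + sum Q_j / (w - z_j) acting on the charge at w, whose real and imaginary parts give the
  two partial derivatives of E. H(w) is also a nonzero multiple of the residue at the double pole w
  of Psi (for roots of q) or of Psi^(-2) (for roots of p). An antiderivative forces these residues to
  vanish, by integration over a small circle. Conversely, when they vanish, an ansatz T/q (or T/p)
  with polynomial T can be solved for the factor in front of the exponential.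
*)

theory Submission
  imports Defs
begin

subsection \<open>Polynomials with simple roots\<close>

text \<open>Roots are split off one at a time. As they are distinct, the remaining ones are roots of
  the quotient.\<close>

lemma prod_linear_dvd:
  fixes P :: "'a::idom poly"
  assumes "finite I" "inj_on x I" "\<And>i. i \<in> I \<Longrightarrow> poly P (x i) = 0"
  shows "(\<Prod>i\<in>I. [:- x i, 1:]) dvd P"
  using assms
proof (induction I arbitrary: P rule: finite_induct)
  case empty
  then show ?case by simp
next
  case (insert i I)
  from insert.prems(2)[of i] obtain Q where Q: "P = [:- x i, 1:] * Q"
    by (auto simp: poly_eq_0_iff_dvd elim: dvdE)
  have "poly Q (x j) = 0" if "j \<in> I" for j
  proof -
    have "x j \<noteq> x i"
      using insert.prems(1) insert.hyps that by (auto simp: inj_on_def)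
    then show ?thesis
      using insert.prems(2)[of j] that unfolding Q by auto
  qed
  then have "(\<Prod>i\<in>I. [:- x i, 1:]) dvd Q"
    using insert.IH[of Q] insert.prems(1) by simp
  then show ?case
    unfolding Q prod.insert[OF insert.hyps] by (rule mult_dvd_mono[OF dvd_refl])
qed

lemma poly_prod_linear_eq_0_iff:
  fixes a :: "'a::idom"
  assumes "finite I"
  shows "poly (\<Prod>i\<in>I. [:- x i, 1:]) a = 0 \<longleftrightarrow> a \<in> x ` I"
  using assms by (auto simp: poly_prod)

lemma ex_interpolating_poly:
  fixes x f :: "'b \<Rightarrow> 'a::field"
  assumes "finite I" "inj_on x I"
  shows "\<exists>T. \<forall>i\<in>I. poly T (x i) = f i"
  using assms
proof (induction I rule: finite_induct)
  case empty
  then show ?case by simp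
next
  case (insert i I)
  then obtain T where T: "\<forall>i\<in>I. poly T (x i) = f i"
    by auto
  let ?D = "\<Prod>i\<in>I. [:- x i, 1:]"
  have D: "poly ?D (x i) \<noteq> 0"
    using insert by (auto simp: poly_prod_linear_eq_0_iff)
  have "poly ?D (x j) = 0" if "j \<in> I" for j
    using insert that by (simp add: poly_prod_linear_eq_0_iff)
  \<comment> \<open>Newton interpolation: a multiple of the node polynomial corrects the value at
    the new node without disturbing the old ones.\<close>
  then have "\<forall>j\<in>insert i I. poly (T + smult ((f i - poly T (x i)) / poly ?D (x i)) ?D) (x j) = f j"
    using T D by auto
  then show ?case by blast
qed

text \<open>The logarithmic derivative of a product, multiplied out. It turns values of
  \<open>pderiv p\<close> and \<open>pderiv q\<close> into sums of Coulomb forces.\<close>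

lemma poly_pderiv_prod_linear:
  fixes a :: "'a::field"
  assumes "finite I" "a \<notin> x ` I"
  shows "poly (pderiv (\<Prod>i\<in>I. [:- x i, 1:])) a =
    poly (\<Prod>i\<in>I. [:- x i, 1:]) a * (\<Sum>i\<in>I. 1 / (a - x i))"
  using assms
proof (induction I rule: finite_induct)
  case empty
  then show ?case by (simp add: pderiv_1)
next
  case (insert i I)
  then have "a - x i \<noteq> 0" by auto
  with insert show ?case
    by (simp add: pderiv_mult pderiv_pCons field_simps del: mult_pCons_left)
qed

lemma poly_pderiv_linear_mult:
  fixes E :: "'a::idom poly"
  shows "poly (pderiv ([:- a, 1:] * E)) a = poly E a"
    and "poly (pderiv (pderiv ([:- a, 1:] * E))) a = 2 * poly (pderiv E) a"
  by (simp_all add: pderiv_mult pderiv_pCons pderiv_add pderiv_diff pderiv_smult)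

text \<open>With \<open>D = (X - a) E\<close> one has \<open>D'(a) = E(a)\<close> and
  \<open>D''(a) = 2 E'(a)\<close>, so the logarithmic derivative of the cofactor \<open>E\<close>
  yields the force at \<open>a\<close> without self-interaction.\<close>

lemma poly_pderiv_prod_linear_root:
  fixes x :: "'b \<Rightarrow> 'a::field"
  assumes I: "finite I" "inj_on x I" and i: "i \<in> I"
  defines "D \<equiv> \<Prod>i\<in>I. [:- x i, 1:]"
  shows "poly (pderiv D) (x i) \<noteq> 0"
    and "poly (pderiv (pderiv D)) (x i) =
      2 * poly (pderiv D) (x i) * (\<Sum>j\<in>I-{i}. 1 / (x i - x j))"
proof -
  let ?E = "\<Prod>j\<in>I-{i}. [:- x j, 1:]"
  have D: "D = [:- x i, 1:] * ?E"
    unfolding D_def using I(1) i by (rule prod.remove)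
  have notin: "x i \<notin> x ` (I - {i})"
    using I(2) i by (auto simp: inj_on_def)
  then show "poly (pderiv D) (x i) \<noteq> 0"
    unfolding D poly_pderiv_linear_mult using I(1) by (simp add: poly_prod_linear_eq_0_iff)
  show "poly (pderiv (pderiv D)) (x i) =
      2 * poly (pderiv D) (x i) * (\<Sum>j\<in>I-{i}. 1 / (x i - x j))"
    unfolding D poly_pderiv_linear_mult using I(1) notin by (simp add: poly_pderiv_prod_linear)
qed

text \<open>Bounds in place of exact degrees let this apply to second derivatives too. A constant
  \<open>a\<close> is treated apart: its degree cannot drop, but its derivative is zero.\<close>

lemma degree_pderiv_mult_less:
  fixes a b :: "'a::{comm_semiring_1,semiring_no_zero_divisors,semiring_char_0} poly"
  assumes "degree a \<le> s" "degree b \<le> t" "0 < s + t"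
  shows "degree (pderiv a * b) < s + t"
proof (cases "degree a = 0")
  case True
  then have "pderiv a = 0" by (simp add: pderiv_eq_0_iff)
  then show ?thesis using assms by simp
next
  case False
  then show ?thesis
    using degree_mult_le[of "pderiv a" b] assms by (simp add: degree_pderiv)
qed

subsection \<open>Rational primitives of rational functions times an exponential\<close>

text \<open>This makes \<open>U * exp (c z)\<close> a primitive of \<open>P * exp (c z)\<close>:
  termwise integration for \<open>c = 0\<close>, repeated integration by parts otherwise.\<close>

lemma ex_poly_pderiv_plus_smult:
  fixes P :: "'a::field_char_0 poly"
  shows "\<exists>U. pderiv U + smult c U = P"
proof (cases "c = 0")
  case True
  let ?U = "\<Sum>i\<le>degree P. monom (coeff P i / of_nat (Suc i)) (Suc i)"
  have "pderiv ?U = (\<Sum>i\<le>degree P. monom (coeff P i) i)"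
    by (simp add: higher_pderiv_sum[of 1, simplified] pderiv_monom del: of_nat_Suc)
  also have "\<dots> = P"
    by (rule poly_as_sum_of_monoms)
  finally have "pderiv ?U + smult c ?U = P"
    using True by simp
  then show ?thesis by blast
next
  case False
  show ?thesis
  proof (induction "degree P" arbitrary: P rule: less_induct)
    case less
    show ?case
    proof (cases "degree P = 0")
      case True
      then have "pderiv (smult (1 / c) P) + smult c (smult (1 / c) P) = P"
        using False by (simp add: pderiv_smult pderiv_eq_0_iff)
      then show ?thesis by blast
    next
      case deg: False
      then have "degree (pderiv P) < degree P"
        by (simp add: degree_pderiv)
      from less[OF this] obtain U where "pderiv P = pderiv U + smult c U"
        by metis
      \<comment> \<open>The derivative of \<open>(P - U) / c\<close> is \<open>U\<close>, since
        \<open>U\<close> solves the equation for \<open>pderiv P\<close>.\<close>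
      then have "pderiv (smult (1 / c) (P - U)) + smult c (smult (1 / c) (P - U)) = P"
        using False by (simp add: pderiv_smult pderiv_diff smult_diff_right smult_add_right)
      then show ?thesis by blast
    qed
  qed
qed

text \<open>The polynomial equation says that \<open>T/D * exp (c z)\<close> is a primitive of \<open>N/D\<^sup>2 * exp (c z)\<close>. Up to
  a factor, the hypothesis is the vanishing of the residue of the latter at the double pole \<open>x i\<close>.
  Interpolating \<open>- N / pderiv D\<close> gives a \<open>T\<close> that matches all principal parts.\<close>

lemma ex_rational_primitive:
  fixes x :: "'b \<Rightarrow> 'a::field_char_0"
  assumes I: "finite I" "inj_on x I"
  defines "D \<equiv> \<Prod>i\<in>I. [:- x i, 1:]"
  assumes res: "\<And>i. i \<in> I \<Longrightarrow>
    poly (pderiv N * pderiv D + smult c (N * pderiv D) - N * pderiv (pderiv D)) (x i) = 0"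
  shows "\<exists>T. pderiv T * D - T * pderiv D + smult c (T * D) = N"
proof -
  obtain T where T: "\<forall>i\<in>I. poly T (x i) = - poly N (x i) / poly (pderiv D) (x i)"
    using ex_interpolating_poly[OF I, of "\<lambda>i. - poly N (x i) / poly (pderiv D) (x i)"] by blast
  note D' = poly_pderiv_prod_linear_root(1)[OF I, folded D_def]
  have D0: "poly D (x i) = 0" if "i \<in> I" for i
    using I that by (simp add: D_def poly_prod_linear_eq_0_iff)
  have "D dvd T * pderiv D + N"
    unfolding D_def using D' T by (intro prod_linear_dvd I) (auto simp: D_def)
  then obtain S where S: "T * pderiv D + N = D * S" ..
  \<comment> \<open>Cancelling \<open>D\<close> in the goal equation leaves \<open>M = 0\<close>, so
    \<open>M\<close> measures the failure of the first guess \<open>T\<close>. Replacing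
    \<open>T\<close> by \<open>T + D * U\<close> repairs it if
    \<open>M = D * (pderiv U + smult c U)\<close>, which requires \<open>D dvd M\<close>.\<close>
  define M where "M = S - pderiv T - smult c T"
  have "poly M (x i) = 0" if i: "i \<in> I" for i
  proof -
    \<comment> \<open>\<open>S\<close> is known only through \<open>D * S\<close>; differentiating
      at a root of \<open>D\<close> exposes its value there.\<close>
    have "poly (pderiv (T * pderiv D + N)) (x i) = poly (pderiv (D * S)) (x i)"
      by (simp add: S)
    then have "poly (pderiv D) (x i) * poly M (x i) =
        poly T (x i) * poly (pderiv (pderiv D)) (x i) + poly (pderiv N) (x i)
          - c * (poly T (x i) * poly (pderiv D) (x i))"
      using D0[OF i] by (simp add: pderiv_add pderiv_mult M_def algebra_simps)
    moreover have TD: "poly T (x i) * poly (pderiv D) (x i) = - poly N (x i)"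
      using T D'[OF i] i by simp
    ultimately have "poly (pderiv D) (x i) * (poly (pderiv D) (x i) * poly M (x i)) =
        - poly N (x i) * poly (pderiv (pderiv D)) (x i)
          + poly (pderiv D) (x i) * poly (pderiv N) (x i)
          + c * poly (pderiv D) (x i) * poly N (x i)"
      by algebra
    also have "\<dots> = 0"
      using res[OF i] by (simp add: algebra_simps)
    finally show ?thesis using D'[OF i] by simp
  qed
  then have "D dvd M"
    unfolding D_def by (intro prod_linear_dvd I)
  then obtain P where P: "M = D * P" ..
  obtain U where U: "pderiv U + smult c U = P"
    using ex_poly_pderiv_plus_smult by blast
  have N: "N = D * S - T * pderiv D"
    using S by (simp add: algebra_simps)
  have S': "S = pderiv T + smult c T + D * (pderiv U + smult c U)"
    using P unfolding U M_def by (simp add: algebra_simps)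
  \<comment> \<open>The correction \<open>D * U\<close> adds exactly
    \<open>D\<^sup>2 * (pderiv U + smult c U)\<close> to the left-hand side.\<close>
  have "pderiv (T + D * U) * D - (T + D * U) * pderiv D + smult c ((T + D * U) * D) = N"
    unfolding N S' by (simp add: pderiv_add pderiv_mult algebra_simps smult_add_right)
  then show ?thesis by blast
qed

lemma has_field_derivative_rational_exp:
  fixes z :: complex
  assumes "pderiv T * D - T * pderiv D + smult c (T * D) = N" "poly D z \<noteq> 0"
  shows "((\<lambda>z. poly T z / poly D z * exp (c * z)) has_field_derivative
    poly N z / poly D z ^ 2 * exp (c * z)) (at z)"
proof -
  have "poly N z = poly (pderiv T) z * poly D z - poly T z * poly (pderiv D) z
      + c * (poly T z * poly D z)"
    by (simp flip: assms(1))
  then show ?thesis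
    using assms(2)
    by (auto intro!: derivative_eq_intros simp: divide_simps power2_eq_square) (simp add: algebra_simps)
qed

section \<open>Residues at double poles\<close>

text \<open>The integral over a small circle is zero because of the primitive, and
  \<open>2 * pi * \<i> * deriv g a\<close> by Cauchy's formula for the derivative.\<close>

lemma deriv_eq_0_if_primitive_double_pole:
  fixes g :: "complex \<Rightarrow> complex"
  assumes g: "g analytic_on {a}"
    and F: "\<forall>\<^sub>F z in at a. (F has_field_derivative g z / (z - a)\<^sup>2) (at z)"
  shows "deriv g a = 0"
proof -
  obtain e where e: "e > 0" "g holomorphic_on ball a e"
    using g by (auto simp: analytic_on_def)
  obtain d where d: "d > 0"
      "\<And>z. z \<noteq> a \<Longrightarrow> dist z a < d \<Longrightarrow> (F has_field_derivative g z / (z - a)\<^sup>2) (at z)"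
    using F by (auto simp: eventually_at)
  define r where "r = min d e / 2"
  have r: "r > 0" "r < d" "r < e"
    using d(1) e(1) by (auto simp: r_def)
  have hol: "g holomorphic_on cball a r"
    using r by (intro holomorphic_on_subset[OF e(2)]) auto
  have "((\<lambda>z. g z / (z - a)\<^sup>2) has_contour_integral
      F (pathfinish (circlepath a r)) - F (pathstart (circlepath a r))) (circlepath a r)"
  proof (rule contour_integral_primitive)
    fix z assume z: "z \<in> sphere a r"
    then have "z \<noteq> a" "dist z a < d"
      using r by (auto simp: dist_commute)
    then show "(F has_field_derivative g z / (z - a)\<^sup>2) (at z within sphere a r)"
      using d(2) has_field_derivative_at_within by blast
  qed (use r in auto)
  then have "contour_integral (circlepath a r) (\<lambda>z. g z / (z - a)\<^sup>2) = 0"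
    by (simp add: contour_integral_unique)
  moreover have "contour_integral (circlepath a r) (\<lambda>z. g z / (z - a)\<^sup>2) = 2 * pi * \<i> * deriv g a"
    using hol r(1)
    by (intro Cauchy_contour_integral_circlepath_2)
      (auto intro: holomorphic_on_imp_continuous_on holomorphic_on_subset)
  ultimately show ?thesis by simp
qed

lemma residue_condition_if_primitive:
  fixes x :: "'b \<Rightarrow> complex"
  assumes I: "finite I" "inj_on x I" and i: "i \<in> I"
  defines "D \<equiv> \<Prod>i\<in>I. [:- x i, 1:]"
  assumes F: "\<forall>\<^sub>F z in at (x i).
    (F has_field_derivative poly N z / poly D z ^ 2 * exp (c * z)) (at z)"
  shows "poly (pderiv N * pderiv D + smult c (N * pderiv D) - N * pderiv (pderiv D)) (x i) = 0"
proof -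
  let ?E = "\<Prod>j\<in>I-{i}. [:- x j, 1:]"
  \<comment> \<open>\<open>g\<close> is the integrand with its double pole at \<open>x i\<close>
    removed, so \<open>deriv g (x i)\<close> is the residue.\<close>
  define g where "g z = poly N z / poly ?E z ^ 2 * exp (c * z)" for z
  have D: "D = [:- x i, 1:] * ?E"
    unfolding D_def using I(1) i by (rule prod.remove)
  have E: "poly ?E (x i) \<noteq> 0"
    using I i by (auto simp: poly_prod_linear_eq_0_iff inj_on_def)
  have "poly N z / poly D z ^ 2 * exp (c * z) = g z / (z - x i)\<^sup>2" for z
    by (simp add: D g_def power_mult_distrib mult.commute del: mult_pCons_left)
  with F have "\<forall>\<^sub>F z in at (x i). (F has_field_derivative g z / (z - x i)\<^sup>2) (at z)"
    by simp
  moreover have "g analytic_on {x i}"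
    unfolding g_def using E
    by (intro analytic_intros)
      (auto simp: analytic_on_holomorphic holomorphic_on_def field_differentiable_def intro: poly_DERIV)
  ultimately have "deriv g (x i) = 0"
    by (intro deriv_eq_0_if_primitive_double_pole)
  moreover have "(g has_field_derivative
      exp (c * x i) / poly ?E (x i) ^ 3 * (poly (pderiv N) (x i) * poly ?E (x i)
        + c * poly N (x i) * poly ?E (x i) - 2 * poly N (x i) * poly (pderiv ?E) (x i))) (at (x i))"
    unfolding g_def using E
    by (auto intro!: derivative_eq_intros simp: field_simps power2_eq_square power3_eq_cube)
  ultimately have "poly (pderiv N) (x i) * poly ?E (x i)
        + c * poly N (x i) * poly ?E (x i) - 2 * poly N (x i) * poly (pderiv ?E) (x i) = 0"
    using E by (simp add: DERIV_imp_deriv)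
  \<comment> \<open>By \<open>D'(a) = E(a)\<close> and \<open>D''(a) = 2 E'(a)\<close> at
    \<open>a = x i\<close>, the last equation is the claim.\<close>
  then show ?thesis
    unfolding D poly_diff poly_add poly_mult poly_smult poly_pderiv_linear_mult
    by (simp add: mult_ac)
qed

text \<open>The set \<open>S\<close> may omit further points besides the roots of \<open>D\<close>;
  for \<open>Psi\<close> these are the roots of the other polynomial.\<close>

lemma ex_rational_primitive_iff:
  fixes x :: "'b \<Rightarrow> complex"
  assumes I: "finite I" "inj_on x I"
  defines "D \<equiv> \<Prod>i\<in>I. [:- x i, 1:]"
  assumes S: "finite (- S)" "\<And>z. z \<in> S \<Longrightarrow> poly D z \<noteq> 0"
    and f: "\<And>z. z \<in> S \<Longrightarrow> f z = poly N z / poly D z ^ 2 * exp (c * z)"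
  shows "(\<exists>F. antiderivative_on S f F \<and> rational_on S (\<lambda>z. exp (- c * z) * F z)) \<longleftrightarrow>
    (\<forall>i\<in>I. poly (pderiv N * pderiv D + smult c (N * pderiv D) - N * pderiv (pderiv D)) (x i) = 0)"
    (is "?L \<longleftrightarrow> ?R")
proof
  assume ?L
  then obtain F where F: "\<And>z. z \<in> S \<Longrightarrow> (F has_field_derivative f z) (at z)"
    unfolding antiderivative_on_def by blast
  \<comment> \<open>A cofinite set contains a punctured neighbourhood of every point, in particular
    of the poles.\<close>
  have "\<forall>\<^sub>F z in at a. z \<in> S" for a
    using S(1) islimpt_finite[of "- S" a] by (simp add: islimpt_iff_eventually)
  then have "\<forall>\<^sub>F z in at a. (F has_field_derivative poly N z / poly D z ^ 2 * exp (c * z)) (at z)" for a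
    by (rule eventually_mono) (use F f in force)
  then show ?R
    unfolding D_def using residue_condition_if_primitive[OF I] by blast
next
  assume ?R
  then obtain T where T: "pderiv T * D - T * pderiv D + smult c (T * D) = N"
    unfolding D_def using ex_rational_primitive[OF I] by blast
  define F where "F z = poly T z / poly D z * exp (c * z)" for z
  have "antiderivative_on S f F"
    unfolding antiderivative_on_def F_def
    using has_field_derivative_rational_exp[OF T] S(2) f by simp
  moreover have "D \<noteq> 0"
    unfolding D_def using I(1) by simp
  then have "rational_on S (\<lambda>z. exp (- c * z) * F z)"
    unfolding rational_on_def F_def using S(2)
    by (intro exI[of _ T] exI[of _ D]) (simp add: exp_minus field_simps)
  ultimately show ?L by blast
qed

subsection \<open>The gradient of the energy\<close>

text \<open>Formally \<open>ln (cmod w)\<close> is the real part of \<open>log w\<close>;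
  differentiating the norm avoids choosing a branch.\<close>

lemma has_real_derivative_ln_cmod:
  assumes "(\<gamma> has_vector_derivative c) (at t)" "\<gamma> t \<noteq> 0"
  shows "((\<lambda>t. ln (cmod (\<gamma> t))) has_real_derivative Re (c / \<gamma> t)) (at t)"
proof -
  have "((\<lambda>t. cmod (\<gamma> t)) has_derivative (\<lambda>h. sgn (\<gamma> t) \<bullet> (h *\<^sub>R c))) (at t)"
    using has_derivative_compose[OF assms(1)[unfolded has_vector_derivative_def]
        has_derivative_norm[OF assms(2)]] by (simp add: inner_commute)
  then have "((\<lambda>t. cmod (\<gamma> t)) has_real_derivative sgn (\<gamma> t) \<bullet> c) (at t)"
    by (simp add: has_field_derivative_def mult_commute_abs)
  then have "((\<lambda>t. ln (cmod (\<gamma> t))) has_real_derivative 1 / cmod (\<gamma> t) * (sgn (\<gamma> t) \<bullet> c)) (at t)"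
    using assms(2) by (intro DERIV_chain2[OF DERIV_ln_divide]) simp_all
  \<comment> \<open>The inner product of \<open>w\<close> and \<open>c\<close> is the real part of
    \<open>c * cnj w\<close>, and \<open>cnj w / (cmod w)\<^sup>2 = 1 / w\<close>.\<close>
  moreover have "1 / cmod (\<gamma> t) * (sgn (\<gamma> t) \<bullet> c) = Re (c / \<gamma> t)"
    using assms(2)
    by (simp add: sgn_div_norm Re_divide inner_complex_def flip: cmod_power2)
      (simp add: field_simps power2_eq_square)
  ultimately show ?thesis by simp
qed

text \<open>Only pairs containing \<open>i\<close> contribute. For pairs \<open>(a, i)\<close>
  numerator and denominator both change sign, so they give the same kind of term as pairs
  \<open>(i, b)\<close>.\<close>

lemma sum_pairs_involving:
  fixes z :: "nat \<Rightarrow> complex" and Q :: "nat \<Rightarrow> real" and c :: complex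
  assumes i: "i \<in> {1..N}"
  shows "(\<Sum>a=1..N. \<Sum>b=a+1..N. Q a * Q b *
      ((if a = i then c else 0) - (if b = i then c else 0)) / (z a - z b)) =
    c * Q i * (\<Sum>j\<in>{1..N}-{i}. Q j / (z i - z j))"
proof -
  define u where "u j = c * Q i * (Q j / (z i - z j))" for j
  have "(\<Sum>a=1..N. \<Sum>b=a+1..N. Q a * Q b *
      ((if a = i then c else 0) - (if b = i then c else 0)) / (z a - z b)) =
    (\<Sum>a=1..N. \<Sum>b=a+1..N. (if a = i then u b else 0) + (if b = i then u a else 0))"
  proof (intro sum.cong refl)
    fix a b assume "b \<in> {a+1..N}"
    then have "a \<noteq> b" by simp
    moreover have "- (w / (z a - z i)) = w / (z i - z a)" for w
      by (metis minus_diff_eq minus_divide_right)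
    ultimately show "Q a * Q b * ((if a = i then c else 0) - (if b = i then c else 0)) / (z a - z b) =
      (if a = i then u b else 0) + (if b = i then u a else 0)"
      by (auto simp: u_def mult_ac)
  qed
  \<comment> \<open>Pairs with \<open>i\<close> in front supply the indices above \<open>i\<close>,
    pairs with \<open>i\<close> behind those below.\<close>
  also have "\<dots> = (\<Sum>a=1..N. if a = i then \<Sum>b=i+1..N. u b else 0) + (\<Sum>a=1..N. if a < i then u a else 0)"
    unfolding sum.distrib
  proof (intro arg_cong2[where f = "(+)"] sum.cong refl)
    fix a
    show "(\<Sum>b=a+1..N. if a = i then u b else 0) = (if a = i then \<Sum>b=i+1..N. u b else 0)"
      by simp
    show "(\<Sum>b=a+1..N. if b = i then u a else 0) = (if a < i then u a else 0)"
      using i by (auto simp: sum.delta)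
  qed
  also have "\<dots> = sum u {i+1..N} + sum u {1..<i}"
  proof -
    have "{1..N} \<inter> {a. a < i} = {1..<i}"
      using i by auto
    then show ?thesis
      using i by (simp add: sum.delta sum.If_cases)
  qed
  also have "\<dots> = sum u ({i+1..N} \<union> {1..<i})"
    by (rule sum.union_disjoint[symmetric]) auto
  also have "{i+1..N} \<union> {1..<i} = {1..N} - {i}"
    using i by auto
  finally show ?thesis
    by (simp add: u_def sum_distrib_left)
qed

text \<open>Moving one charge along a curve of velocity \<open>c\<close> covers both partial
  derivatives at once, with \<open>c = 1\<close> and \<open>c = \<i>\<close>.\<close>

lemma has_real_derivative_energy:
  fixes z :: "nat \<Rightarrow> complex" and c :: complex
  assumes z: "inj_on z {1..n+m}" and i: "i \<in> {1..n+m}"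
    and \<gamma>: "(\<gamma> has_vector_derivative c) (at t)" "\<gamma> t = z i"
  shows "((\<lambda>t. energy k n m (z(i := \<gamma> t))) has_real_derivative
    Re (c * charge n i * (k + (\<Sum>j\<in>{1..n+m}-{i}. charge n j / (z i - z j))))) (at t)"
proof -
  \<comment> \<open>\<open>\<delta> a\<close> is the velocity of the charge with index
    \<open>a\<close>.\<close>
  define \<delta> where "\<delta> a = (if a = i then c else 0)" for a
  have Z: "((\<lambda>t. (z(i := \<gamma> t)) a) has_vector_derivative \<delta> a) (at t)" for a
    using \<gamma>(1) by (auto simp: \<delta>_def)
  have Zt: "z(i := \<gamma> t) = z"
    using \<gamma>(2) by auto
  have "((\<lambda>t. k * (\<Sum>a=1..n+m. complex_of_real (charge n a) * (z(i := \<gamma> t)) a))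
      has_vector_derivative k * (\<Sum>a=1..n+m. complex_of_real (charge n a) * \<delta> a)) (at t)"
    by (intro has_vector_derivative_mult_right has_vector_derivative_sum Z)
  moreover have "(\<Sum>a=1..n+m. complex_of_real (charge n a) * \<delta> a) = c * charge n i"
    using i by (simp add: \<delta>_def if_distrib[of "(*) _"] mult.commute cong: if_cong)
  ultimately have lin: "((\<lambda>t. Re (k * (\<Sum>a=1..n+m. complex_of_real (charge n a) * (z(i := \<gamma> t)) a)))
      has_real_derivative Re (k * (c * charge n i))) (at t)"
    by (simp only: has_vector_derivative_complex_iff)
  have pair: "((\<lambda>t. charge n a * charge n b * ln (cmod ((z(i := \<gamma> t)) a - (z(i := \<gamma> t)) b)))
      has_real_derivative charge n a * charge n b * Re ((\<delta> a - \<delta> b) / (z a - z b))) (at t)"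
    if "a \<in> {1..n+m}" "b \<in> {a+1..n+m}" for a b
  proof -
    have "z a \<noteq> z b"
      using inj_on_eq_iff[OF z, of a b] that by simp
    then show ?thesis
      using has_real_derivative_ln_cmod[OF has_vector_derivative_diff[OF Z[of a] Z[of b]]]
      by (intro DERIV_cmult) (simp add: Zt)
  qed
  have "(\<Sum>a=1..n+m. \<Sum>b=a+1..n+m. charge n a * charge n b * Re ((\<delta> a - \<delta> b) / (z a - z b))) =
      Re (\<Sum>a=1..n+m. \<Sum>b=a+1..n+m. charge n a * charge n b * (\<delta> a - \<delta> b) / (z a - z b))"
    unfolding Re_sum
    by (intro sum.cong refl) (simp flip: of_real_mult times_divide_eq_right)
  also have "\<dots> = Re (c * charge n i * (\<Sum>j\<in>{1..n+m}-{i}. charge n j / (z i - z j)))"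
    unfolding \<delta>_def by (subst sum_pairs_involving[OF i]) (rule refl)
  finally have "Re (c * charge n i * (k + (\<Sum>j\<in>{1..n+m}-{i}. charge n j / (z i - z j)))) =
      Re (k * (c * charge n i)) +
      (\<Sum>a=1..n+m. \<Sum>b=a+1..n+m. charge n a * charge n b * Re ((\<delta> a - \<delta> b) / (z a - z b)))"
    by (simp add: algebra_simps)
  then show ?thesis
    unfolding energy_def by (simp only:) (intro DERIV_add lin DERIV_sum pair)
qed

lemma critical_point_energy_iff:
  fixes z :: "nat \<Rightarrow> complex"
  assumes z: "inj_on z {1..n+m}"
  shows "critical_point {1..n+m} (energy k n m) z \<longleftrightarrow>
    (\<forall>i\<in>{1..n+m}. k + (\<Sum>j\<in>{1..n+m}-{i}. charge n j / (z i - z j)) = 0)"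
  unfolding critical_point_def
proof (intro ball_cong refl)
  fix i assume i: "i \<in> {1..n+m}"
  define W where "W = charge n i * (k + (\<Sum>j\<in>{1..n+m}-{i}. charge n j / (z i - z j)))"
  have "((\<lambda>t. Complex t (Im (z i))) has_vector_derivative 1) (at (Re (z i)))"
    by (auto simp: has_vector_derivative_complex_iff)
  from has_real_derivative_energy[OF z i this]
  have Re: "((\<lambda>t. energy k n m (z(i := Complex t (Im (z i))))) has_real_derivative Re W) (at (Re (z i)))"
    by (simp add: W_def)
  have "((\<lambda>t. Complex (Re (z i)) t) has_vector_derivative \<i>) (at (Im (z i)))"
    by (auto simp: has_vector_derivative_complex_iff)
  from has_real_derivative_energy[OF z i this]
  have Im: "((\<lambda>t. energy k n m (z(i := Complex (Re (z i)) t))) has_real_derivative - Im W) (at (Im (z i)))"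
    by (simp add: W_def mult.assoc)
  have "((\<lambda>t. energy k n m (z(i := Complex t (Im (z i))))) has_real_derivative 0) (at (Re (z i))) \<and>
      ((\<lambda>t. energy k n m (z(i := Complex (Re (z i)) t))) has_real_derivative 0) (at (Im (z i)))
      \<longleftrightarrow> W = 0"
    using DERIV_unique[OF Re, of 0] DERIV_unique[OF Im, of 0] Re Im
    by (cases "W = 0") (auto simp: complex_eq_iff)
  \<comment> \<open>The charges 1 and -2 are nonzero and can be cancelled.\<close>
  also have "\<dots> \<longleftrightarrow> k + (\<Sum>j\<in>{1..n+m}-{i}. charge n j / (z i - z j)) = 0"
    by (simp add: W_def charge_def)
  finally show "((\<lambda>t. energy k n m (z(i := Complex t (Im (z i))))) has_real_derivative 0) (at (Re (z i))) \<and>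
      ((\<lambda>t. energy k n m (z(i := Complex (Re (z i)) t))) has_real_derivative 0) (at (Im (z i)))
      \<longleftrightarrow> k + (\<Sum>j\<in>{1..n+m}-{i}. charge n j / (z i - z j)) = 0" .
qed
subsection \<open>The three conditions at the roots\<close>

text \<open>The polynomial \<open>H\<close> of the overview.\<close>

definition bilinear_expr :: "complex \<Rightarrow> complex poly \<Rightarrow> complex poly \<Rightarrow> complex poly" where
  "bilinear_expr k p q = pderiv (pderiv p) * q - 4 * pderiv p * pderiv q + 4 * p * pderiv (pderiv q)
    + smult (2 * k) (pderiv p * q - 2 * pderiv q * p)"

context
  fixes k :: complex and n m :: nat and x y :: "nat \<Rightarrow> complex" and p q :: "complex poly"
  assumes p_def: "p = (\<Prod>i=1..n. [:- x i, 1:])"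
    and q_def: "q = (\<Prod>i=1..m. [:- y i, 1:])"
    and x: "inj_on x {1..n}"
    and y: "inj_on y {1..m}"
    and disj: "x ` {1..n} \<inter> y ` {1..m} = {}"
begin

lemma poly_p_eq_0_iff: "poly p z = 0 \<longleftrightarrow> z \<in> x ` {1..n}"
  unfolding p_def by (rule poly_prod_linear_eq_0_iff) simp

lemma poly_q_eq_0_iff: "poly q z = 0 \<longleftrightarrow> z \<in> y ` {1..m}"
  unfolding q_def by (rule poly_prod_linear_eq_0_iff) simp

lemma q_neq_0: "i \<in> {1..n} \<Longrightarrow> poly q (x i) \<noteq> 0"
  and p_neq_0: "j \<in> {1..m} \<Longrightarrow> poly p (y j) \<noteq> 0"
  using disj unfolding poly_p_eq_0_iff poly_q_eq_0_iff by blast+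

lemma poly_bilinear_x:
  assumes "i \<in> {1..n}"
  shows "poly (bilinear_expr k p q) (x i) = poly (pderiv (pderiv p)) (x i) * poly q (x i)
    - 4 * poly (pderiv p) (x i) * poly (pderiv q) (x i) + 2 * k * poly (pderiv p) (x i) * poly q (x i)"
  using assms poly_p_eq_0_iff[of "x i"] by (simp add: bilinear_expr_def)

lemma poly_bilinear_y:
  assumes "j \<in> {1..m}"
  shows "poly (bilinear_expr k p q) (y j) = 4 * (poly p (y j) * poly (pderiv (pderiv q)) (y j)
    - poly (pderiv p) (y j) * poly (pderiv q) (y j) - k * poly (pderiv q) (y j) * poly p (y j))"
  using assms poly_q_eq_0_iff[of "y j"] by (simp add: bilinear_expr_def algebra_simps)

text \<open>Every term contains a derivative, so the degree is below \<open>n + m\<close>, the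
  number of distinct roots of \<open>p\<close> and \<open>q\<close> together.\<close>

lemma bilinear_eq_0_iff:
  "bilinear_expr k p q = 0 \<longleftrightarrow>
    (\<forall>i\<in>{1..n}. poly (bilinear_expr k p q) (x i) = 0) \<and>
    (\<forall>j\<in>{1..m}. poly (bilinear_expr k p q) (y j) = 0)"
proof (intro iffI)
  assume R: "(\<forall>i\<in>{1..n}. poly (bilinear_expr k p q) (x i) = 0) \<and>
    (\<forall>j\<in>{1..m}. poly (bilinear_expr k p q) (y j) = 0)"
  have deg: "degree p = n" "degree q = m"
    by (simp_all add: p_def q_def degree_prod_sum_eq)
  show "bilinear_expr k p q = 0"
  proof (cases "n + m = 0")
    \<comment> \<open>Here \<open>p = q = 1\<close>; a degree strictly below 0 is impossible, so
      this case is computed directly.\<close>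
    case True
    then show ?thesis unfolding bilinear_expr_def by (simp add: p_def q_def pderiv_1)
  next
    case False
    then have pos: "0 < n + m" by simp
    have num: "4 = [:4 :: complex:]" "2 = [:2 :: complex:]"
      by (simp_all add: numeral_poly)
    have 1: "degree (pderiv p * q) < n + m" "degree (pderiv q * p) < n + m"
      using degree_pderiv_mult_less[of p n q m] degree_pderiv_mult_less[of q m p n] pos deg
      by (simp_all add: add.commute)
    have 2: "degree (pderiv (pderiv p) * q) < n + m" "degree (p * pderiv (pderiv q)) < n + m"
        "degree (pderiv p * pderiv q) < n + m"
      using degree_pderiv_mult_less[of "pderiv p" n q m] degree_pderiv_mult_less[of "pderiv q" m p n]
        degree_pderiv_mult_less[of p n "pderiv q" m] pos deg
      by (simp_all add: add.commute degree_pderiv mult.commute)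
    have "bilinear_expr k p q = pderiv (pderiv p) * q - smult 4 (pderiv p * pderiv q)
        + smult 4 (p * pderiv (pderiv q)) + smult (2 * k) (pderiv p * q - smult 2 (pderiv q * p))"
      by (simp add: bilinear_expr_def num)
    also have "degree \<dots> < n + m"
      using 1 2 by (intro degree_add_less degree_diff_less le_less_trans[OF degree_smult_le])
    finally have "degree (bilinear_expr k p q) < n + m" .
    moreover have "card (x ` {1..n} \<union> y ` {1..m}) = n + m"
      using disj x y by (simp add: card_Un_disjoint card_image)
    ultimately show ?thesis
      using R pos by (intro poly_eqI_degree[of "x ` {1..n} \<union> y ` {1..m}"]) auto
  qed
qed simp

section \<open>Equilibrium of the charges at the roots\<close>

text \<open>Subsets \<open>A\<close> and \<open>B\<close> are allowed because the charge on which
  the force acts is left out of its own block.\<close>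

lemma sum_charge:
  assumes "A \<subseteq> {1..n}" "B \<subseteq> {1..m}"
  shows "(\<Sum>j\<in>A \<union> (+) n ` B. charge n j / (w - (if j \<le> n then x j else y (j - n)))) =
    (\<Sum>j\<in>A. 1 / (w - x j)) - 2 * (\<Sum>j\<in>B. 1 / (w - y j))"
    (is "sum ?f _ = _")
proof -
  have "finite A" "finite B" "A \<inter> (+) n ` B = {}"
    using assms by (auto dest: finite_subset) force
  then have "sum ?f (A \<union> (+) n ` B) = sum ?f A + sum ?f ((+) n ` B)"
    by (intro sum.union_disjoint) auto
  also have "sum ?f A = (\<Sum>j\<in>A. 1 / (w - x j))"
    using assms by (intro sum.cong) (auto simp: charge_def)
  also have "sum ?f ((+) n ` B) = (\<Sum>j\<in>B. - 2 * (1 / (w - y j)))"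
    using assms by (subst sum.reindex) (auto simp: charge_def intro!: sum.cong)
  also have "\<dots> = - 2 * (\<Sum>j\<in>B. 1 / (w - y j))"
    by (rule sum_distrib_left[symmetric])
  finally show ?thesis
    by simp
qed

text \<open>Logarithmic derivatives convert forces into values of \<open>bilinear_expr\<close>, with
  factor \<open>2 p' q\<close> at roots of \<open>p\<close> and \<open>- 4 p q'\<close> at roots of
  \<open>q\<close>. Both factors are nonzero, as the roots are simple and not shared.\<close>

lemma critical_point_iff:
  "critical_point {1..n+m} (energy k n m) (\<lambda>i. if i \<le> n then x i else y (i - n)) \<longleftrightarrow>
    (\<forall>i\<in>{1..n}. poly (bilinear_expr k p q) (x i) = 0) \<and>
    (\<forall>j\<in>{1..m}. poly (bilinear_expr k p q) (y j) = 0)"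
proof -
  define z where "z i = (if i \<le> n then x i else y (i - n))" for i
  define force where "force i = k + (\<Sum>j\<in>{1..n+m}-{i}. charge n j / (z i - z j))" for i
  have range: "{1..n+m} = {1..n} \<union> (+) n ` {1..m}"
    unfolding image_add_atLeastAtMost by auto
  have "inj_on z {1..n+m}"
  proof (rule inj_onI)
    fix i j assume ij: "i \<in> {1..n+m}" "j \<in> {1..n+m}" "z i = z j"
    \<comment> \<open>This excludes a coincidence between the two blocks of indices.\<close>
    have "x i' \<noteq> y j'" if "i' \<in> {1..n}" "j' \<in> {1..m}" for i' j'
      using disj that by blast
    moreover have "l \<in> {1..n} \<or> \<not> l \<le> n \<and> l - n \<in> {1..m}" if "l \<in> {1..n+m}" for l
      using that by auto
    ultimately consider "i \<in> {1..n}" "j \<in> {1..n}" "x i = x j"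
      | "\<not> i \<le> n" "\<not> j \<le> n" "i - n \<in> {1..m}" "j - n \<in> {1..m}" "y (i - n) = y (j - n)"
      using ij unfolding z_def by (metis atLeastAtMost_iff)
    then show "i = j"
    proof cases
      case 1
      then show ?thesis using x by (simp add: inj_on_eq_iff)
    next
      case 2
      then have "i - n = j - n" using y by (simp add: inj_on_eq_iff)
      with 2 show ?thesis by simp
    qed
  qed
  then have "critical_point {1..n+m} (energy k n m) z \<longleftrightarrow> (\<forall>i\<in>{1..n+m}. force i = 0)"
    unfolding force_def by (rule critical_point_energy_iff)
  also have "\<dots> \<longleftrightarrow> (\<forall>i\<in>{1..n}. force i = 0) \<and> (\<forall>j\<in>{1..m}. force (n + j) = 0)"
    unfolding range by (simp only: ball_Un ball_simps)
  also have "(\<forall>i\<in>{1..n}. force i = 0) \<longleftrightarrow> (\<forall>i\<in>{1..n}. poly (bilinear_expr k p q) (x i) = 0)"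
  proof (intro ball_cong refl)
    fix i assume i: "i \<in> {1..n}"
    have "{1..n+m} - {i} = ({1..n} - {i}) \<union> (+) n ` {1..m}"
      unfolding range using i by auto
    then have force: "force i = k + (\<Sum>j\<in>{1..n}-{i}. 1 / (x i - x j)) - 2 * (\<Sum>j=1..m. 1 / (x i - y j))"
      using sum_charge[of "{1..n} - {i}" "{1..m}" "x i"] i by (simp add: force_def z_def)
    have "poly (pderiv q) (x i) = poly q (x i) * (\<Sum>j=1..m. 1 / (x i - y j))"
      unfolding q_def
      by (rule poly_pderiv_prod_linear[OF finite_atLeastAtMost]) (use disj i in blast)
    moreover note p' = poly_pderiv_prod_linear_root[OF _ x i, folded p_def, simplified]
    ultimately have "poly (bilinear_expr k p q) (x i) = 2 * poly (pderiv p) (x i) * poly q (x i) * force i"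
      unfolding poly_bilinear_x[OF i] force by (simp add: algebra_simps)
    then show "force i = 0 \<longleftrightarrow> poly (bilinear_expr k p q) (x i) = 0"
      using p'(1) q_neq_0[OF i] by simp
  qed
  also have "(\<forall>j\<in>{1..m}. force (n + j) = 0) \<longleftrightarrow> (\<forall>j\<in>{1..m}. poly (bilinear_expr k p q) (y j) = 0)"
  proof (intro ball_cong refl)
    fix i assume i: "i \<in> {1..m}"
    have "{1..n+m} - {n+i} = {1..n} \<union> (+) n ` ({1..m} - {i})"
      unfolding range using i by (auto simp: image_set_diff)
    then have force: "force (n+i) = k + (\<Sum>j=1..n. 1 / (y i - x j)) - 2 * (\<Sum>j\<in>{1..m}-{i}. 1 / (y i - y j))"
      using sum_charge[of "{1..n}" "{1..m} - {i}" "y i"] i by (simp add: force_def z_def)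
    have "poly (pderiv p) (y i) = poly p (y i) * (\<Sum>j=1..n. 1 / (y i - x j))"
      unfolding p_def
      by (rule poly_pderiv_prod_linear[OF finite_atLeastAtMost]) (use disj i in blast)
    moreover note q' = poly_pderiv_prod_linear_root[OF _ y i, folded q_def, simplified]
    ultimately have "poly (bilinear_expr k p q) (y i) = - 4 * poly p (y i) * poly (pderiv q) (y i) * force (n+i)"
      unfolding poly_bilinear_y[OF i] force by (simp add: algebra_simps)
    then show "force (n+i) = 0 \<longleftrightarrow> poly (bilinear_expr k p q) (y i) = 0"
      using q'(1) p_neq_0[OF i] by simp
  qed
  finally show ?thesis
    unfolding z_def .
qed

section \<open>Primitives of \<open>Psi\<close> and of its inverse square\<close>

lemma finite_Compl_regular_set: "finite (- regular_set p q)"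
proof -
  have "- regular_set p q = x ` {1..n} \<union> y ` {1..m}"
    by (auto simp: regular_set_def poly_p_eq_0_iff poly_q_eq_0_iff)
  then show ?thesis by simp
qed

text \<open>The general criterion with \<open>D = q\<close>, \<open>N = p\<close> and
  \<open>c = k\<close>; its residue expression at \<open>y j\<close> is \<open>bilinear_expr\<close>
  divided by -4.\<close>

lemma rational_primitive_Psi_iff:
  "(\<exists>F. antiderivative_on (regular_set p q) (Psi k p q) F \<and>
      rational_on (regular_set p q) (\<lambda>z. exp (- k * z) * F z)) \<longleftrightarrow>
    (\<forall>j\<in>{1..m}. poly (bilinear_expr k p q) (y j) = 0)"
proof -
  have "(\<exists>F. antiderivative_on (regular_set p q) (Psi k p q) F \<and>
      rational_on (regular_set p q) (\<lambda>z. exp (- k * z) * F z)) \<longleftrightarrow>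
    (\<forall>j\<in>{1..m}. poly (pderiv p * pderiv q + smult k (p * pderiv q) - p * pderiv (pderiv q)) (y j) = 0)"
    by (rule ex_rational_primitive_iff[OF _ y, folded q_def])
      (use finite_Compl_regular_set in \<open>auto simp: regular_set_def Psi_def\<close>)
  also have "\<dots> \<longleftrightarrow> (\<forall>j\<in>{1..m}. poly (bilinear_expr k p q) (y j) = 0)"
  proof (intro ball_cong refl)
    fix j assume "j \<in> {1..m}"
    then have "poly (bilinear_expr k p q) (y j) =
        - 4 * poly (pderiv p * pderiv q + smult k (p * pderiv q) - p * pderiv (pderiv q)) (y j)"
      by (simp add: poly_bilinear_y algebra_simps)
    then show "poly (pderiv p * pderiv q + smult k (p * pderiv q) - p * pderiv (pderiv q)) (y j) = 0
        \<longleftrightarrow> poly (bilinear_expr k p q) (y j) = 0"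
      by (simp only: mult_eq_0_iff) simp
  qed
  finally show ?thesis .
qed

text \<open>The same criterion with \<open>D = p\<close>, \<open>N = q ^ 4\<close> and
  \<open>c = - 2 k\<close>; at \<open>x i\<close> the residue expression is
  \<open>bilinear_expr\<close> times \<open>- q ^ 3\<close>.\<close>

lemma rational_primitive_Psi_power_iff:
  "(\<exists>G. antiderivative_on (regular_set p q) (\<lambda>z. Psi k p q z powi (- 2)) G \<and>
      rational_on (regular_set p q) (\<lambda>z. exp (2 * k * z) * G z)) \<longleftrightarrow>
    (\<forall>i\<in>{1..n}. poly (bilinear_expr k p q) (x i) = 0)"
proof -
  \<comment> \<open>This holds for every \<open>z\<close>: where \<open>p\<close> or
    \<open>q\<close> vanishes, both sides are 0 by the convention on division by zero.\<close>
  have Psi: "Psi k p q z powi (- 2) = poly (q ^ 4) z / poly p z ^ 2 * exp (- (2 * k) * z)" for z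
  proof -
    have "exp (- (2 * k) * z) = inverse (exp (k * z) ^ 2)"
      by (simp add: exp_minus mult.assoc flip: exp_double)
    then show ?thesis
      by (simp only:) (simp add: Psi_def power_int_minus power_mult_distrib power_divide
          divide_inverse mult_ac power_inverse
          flip: power_mult)
  qed
  have "(\<exists>G. antiderivative_on (regular_set p q) (\<lambda>z. Psi k p q z powi (- 2)) G \<and>
      rational_on (regular_set p q) (\<lambda>z. exp (- (- (2 * k)) * z) * G z)) \<longleftrightarrow>
    (\<forall>i\<in>{1..n}. poly (pderiv (q ^ 4) * pderiv p + smult (- (2 * k)) (q ^ 4 * pderiv p)
      - q ^ 4 * pderiv (pderiv p)) (x i) = 0)"
    by (rule ex_rational_primitive_iff[OF _ x, folded p_def])
      (use finite_Compl_regular_set in \<open>auto simp: regular_set_def Psi\<close>)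
  also have "\<dots> \<longleftrightarrow> (\<forall>i\<in>{1..n}. poly (bilinear_expr k p q) (x i) = 0)"
  proof (intro ball_cong refl)
    fix i assume i: "i \<in> {1..n}"
    have "pderiv (q ^ 4) = smult 4 (q ^ 3 * pderiv q)"
      using pderiv_power_Suc[of q 3] by (simp add: numeral_eq_Suc)
    then have "poly (pderiv (q ^ 4) * pderiv p + smult (- (2 * k)) (q ^ 4 * pderiv p)
        - q ^ 4 * pderiv (pderiv p)) (x i) = - (poly q (x i) ^ 3 * poly (bilinear_expr k p q) (x i))"
      by (simp add: poly_bilinear_x[OF i] algebra_simps power3_eq_cube power4_eq_xxxx)
    then show "poly (pderiv (q ^ 4) * pderiv p + smult (- (2 * k)) (q ^ 4 * pderiv p)
        - q ^ 4 * pderiv (pderiv p)) (x i) = 0 \<longleftrightarrow> poly (bilinear_expr k p q) (x i) = 0"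
      using q_neq_0[OF i] by simp
  qed
  finally show ?thesis by simp
qed

end

theorem proposition2:
  fixes k :: complex and n m :: nat
    and x y :: "nat \<Rightarrow> complex"
    and p q :: "complex poly"
  assumes p_def: "p = (\<Prod>i=1..n. [:- x i, 1:])"
    and q_def: "q = (\<Prod>i=1..m. [:- y i, 1:])"
    and "inj_on x {1..n}"
    and "inj_on y {1..m}"
    and "x ` {1..n} \<inter> y ` {1..m} = {}"
  defines "A \<equiv>
      (\<exists>F. antiderivative_on (regular_set p q) (Psi k p q) F \<and>
           rational_on (regular_set p q) (\<lambda>z. exp (- k * z) * F z)) \<and>
      (\<exists>G. antiderivative_on (regular_set p q) (\<lambda>z. Psi k p q z powi (- 2)) G \<and>
           rational_on (regular_set p q) (\<lambda>z. exp (2 * k * z) * G z))"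
    and "B \<equiv>
      critical_point {1..n+m} (energy k n m) (\<lambda>i. if i \<le> n then x i else y (i - n))"
    and "C \<equiv>
      pderiv (pderiv p) * q - 4 * pderiv p * pderiv q + 4 * p * pderiv (pderiv q)
        + smult (2 * k) (pderiv p * q - 2 * pderiv q * p) = 0"
  shows "(A \<longleftrightarrow> B) \<and> (B \<longleftrightarrow> C)"
proof -
  note hyps = assms(1-5)
  show ?thesis
    \<comment> \<open>After rewriting, all three statements are the vanishing of
      \<open>bilinear_expr\<close> at all \<open>x i\<close> and all \<open>y j\<close>; the two
      integrals in \<open>A\<close> supply these in the opposite order.\<close>
    unfolding A_def B_def C_def bilinear_expr_def[symmetric]
      rational_primitive_Psi_iff[OF hyps] rational_primitive_Psi_power_iff[OF hyps]
      critical_point_iff[OF hyps] bilinear_eq_0_iff[OF hyps]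
    by blast
qed

end
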